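(* Let $a\in\mathrm{Lip}(\mathbb{R}^+,\mathbb{R}^+)$ (which implies $\lim_{s\to0}s\,a(s)=0$), and let $M,c>0$. Let $N\in\mathbb{N}$, $N\geq2$, and let $r>0$ be small enough that $N|B(0,r)|\leq c$. Let $R>2r$ be small enough that $s\,a(s)\leq\epsilon<M$ for all $s\leq R$. Let $\{x_1,\dots,x_N\}\in(\mathbb{R}^d)^N$ be such that $2r\leq\|x_i-x_j\|\leq\frac R2$ for all $i\neq j$. If $\mu_0$ satisfies $$\mathrm{supp}(\mu_0)\subset\bigcup_{i=1}^N B(x_i,r),$$ then for $\omega:=\bigcup_{i=1}^N B(x_i,r)\in\Omega_c$ and $u\in\mathcal{U}_M$ defined by $$u(t,x)=\begin{cases}-M\frac{x-x_i}{\|x-x_i\|}&\text{for all }x\in B(x_i,r)\setminus\{x_i\},\ i\in\{1,\dots,N\},\\0&\text{otherwise,}\end{cases}$$ the solution of $$\partial_t\mu+\mathrm{div}\big((\xi[\mu]+\chi_\omega u)\mu\big)=0,\qquad\mu(0)=\mu_0,\qquad\xi[\mu](x)=\int_{\mathbb{R}^d}a(\|x-y\|)(y-x)\,d\mu(y),$$ satisfies, for all $t\geq0$, $\mathrm{supp}(\mu(t,\cdot))\subset\bigcup_{i=1}^N B(x_i,r)$.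
   Context: $B(x,r)$ is the ball of center $x$ and radius $r$ in $\mathbb{R}^d$; $|\cdot|$ is Lebesgue measure; $\chi_\omega$ is the indicator function of $\omega$. $\mathcal{U}_M=\{u:\mathbb{R}\times\mathbb{R}^d\to\mathbb{R}^d\text{ measurable}:\|u(t,\cdot)\|_{L^\infty(\mathbb{R}^d)}\leq M\}$, $\Omega_c=\{\omega\subset\mathbb{R}^d:|\omega|\leq c\}$. $\mu(t,\cdot)$ is a compactly supported probability measure on $\mathbb{R}^d$ for every $t$. $\mathrm{Lip}(\mathbb{R}^+,\mathbb{R}^+)$ is the set of Lipschitz functions from $\mathbb{R}^+=[0,\infty)$ to itself. *)

theory Defs
  imports "HOL-Probability.Probability"
begin

definition measure_support :: "'a::topological_space measure \<Rightarrow> 'a set" where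
  "measure_support \<mu> = {x. \<forall>U. open U \<and> x \<in> U \<longrightarrow> emeasure \<mu> U > 0}"

definition compact_prob_measures :: "'a::euclidean_space measure set" where
  "compact_prob_measures =
     {\<mu>. prob_space \<mu> \<and> sets \<mu> = sets borel \<and> compact (measure_support \<mu>)}"

definition admissible_controls :: "real \<Rightarrow> (real \<Rightarrow> 'a::euclidean_space \<Rightarrow> 'a) set" where
  "admissible_controls M =
     {u. (\<lambda>(t, x). u t x) \<in> borel_measurable lebesgue \<and>
         (\<forall>t. esssup lebesgue (\<lambda>x. ereal (norm (u t x))) \<le> ereal M)}"

definition admissible_regions :: "real \<Rightarrow> 'a::euclidean_space set set" where
  "admissible_regions c = {\<omega>. \<omega> \<in> sets lebesgue \<and> emeasure lebesgue \<omega> \<le> ennreal c}"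

definition interaction_field :: "(real \<Rightarrow> real) \<Rightarrow> 'a::euclidean_space measure \<Rightarrow> 'a \<Rightarrow> 'a" where
  "interaction_field a \<mu> x = (LINT y|\<mu>. a (norm (x - y)) *\<^sub>R (y - x))"

definition controlled_velocity ::
  "(real \<Rightarrow> real) \<Rightarrow> 'a::euclidean_space set \<Rightarrow> (real \<Rightarrow> 'a \<Rightarrow> 'a) \<Rightarrow> (real \<Rightarrow> 'a measure)
     \<Rightarrow> real \<Rightarrow> 'a \<Rightarrow> 'a" where
  "controlled_velocity a \<omega> u \<mu> t x =
     interaction_field a (\<mu> t) x + indicator \<omega> x *\<^sub>R u t x"

text \<open>
  Weak formulation of the continuity equation
  \<open>\<partial>\<^sub>t \<mu> + div (w \<mu>) = 0\<close> on \<open>[0,\<infinity>)\<close>: the velocity has locally integrable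
  \<open>L\<^sup>1(\<mu> t)\<close> norm, and for every compactly supported \<open>C\<^sup>1\<close> test function \<open>\<phi>\<close>, with gradient
  \<open>g\<close>, the map \<open>t \<mapsto> \<integral> \<phi> d\<mu>(t)\<close> is locally absolutely continuous with a.e. derivative
  \<open>\<integral> g \<bullet> w(t) d\<mu>(t)\<close>. The latter is stated in integrated form. For probability measures this
  entails continuity of \<open>\<mu>\<close> in time for weak convergence, so this is not required separately.
\<close>

definition weak_continuity_equation ::
  "(real \<Rightarrow> 'a::euclidean_space \<Rightarrow> 'a) \<Rightarrow> (real \<Rightarrow> 'a measure) \<Rightarrow> bool" where
  "weak_continuity_equation w \<mu> \<longleftrightarrow>
     (AE t in lborel. 0 \<le> t \<longrightarrow> integrable (\<mu> t) (w t)) \<and>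
     (\<forall>T\<ge>0. set_integrable lborel {0..T} (\<lambda>t. LINT x|\<mu> t. norm (w t x))) \<and>
     (\<forall>\<phi> g. (\<forall>x. GDERIV \<phi> x :> g x) \<and> continuous_on UNIV g \<and> compact (closure {x. \<phi> x \<noteq> 0}) \<longrightarrow>
        (\<forall>t\<ge>0. set_integrable lborel {0..t} (\<lambda>s. LINT x|\<mu> s. g x \<bullet> w s x) \<and>
               (LINT x|\<mu> t. \<phi> x) =
                 (LINT x|\<mu> 0. \<phi> x) + (LINT s:{0..t}|lborel. (LINT x|\<mu> s. g x \<bullet> w s x))))"

definition krasovskii :: "('a::real_normed_vector \<Rightarrow> 'a) \<Rightarrow> 'a \<Rightarrow> 'a set" where
  "krasovskii v x = (\<Inter>\<delta>\<in>{0<..}. closure (convex hull (v ` ball x \<delta>)))"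

text \<open>
  The velocity is discontinuous when the control is, and then the weak formulation with the
  pointwise values of the velocity may fail to have any solution: with a control that points
  towards a centre \<open>p\<close> and vanishes at \<open>p\<close>, a Dirac mass forms at \<open>p\<close> and is held there, although
  the pointwise velocity \<open>\<xi>[\<mu>](p)\<close> need not vanish. As usual for discontinuous fields, the
  transporting velocity is therefore only required to lie in the Krasovskii regularization of the
  field. Since \<open>v x \<in> krasovskii v x\<close>, this includes all solutions in the usual weak sense, see
  \<open>weak_solution_imp_is_solution\<close>; the Krasovskii set also contains the Filippov one.
\<close>

definition is_solution ::
  "(real \<Rightarrow> real) \<Rightarrow> 'a::euclidean_space set \<Rightarrow> (real \<Rightarrow> 'a \<Rightarrow> 'a) \<Rightarrow> 'a measure
     \<Rightarrow> (real \<Rightarrow> 'a measure) \<Rightarrow> bool" where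
  "is_solution a \<omega> u \<mu>0 \<mu> \<longleftrightarrow>
     (\<forall>t\<ge>0. \<mu> t \<in> compact_prob_measures) \<and> \<mu> 0 = \<mu>0 \<and>
     (\<exists>w. (AE t in lborel. 0 \<le> t \<longrightarrow>
             (AE x in \<mu> t. w t x \<in> krasovskii (controlled_velocity a \<omega> u \<mu> t) x)) \<and>
          weak_continuity_equation w \<mu>)"

lemma in_krasovskii: "v x \<in> krasovskii v x"
proof -
  have "v x \<in> closure (convex hull (v ` ball x \<delta>))" if "\<delta> > 0" for \<delta>
    using that by (intro subsetD[OF closure_subset] hull_inc imageI) simp
  then show ?thesis
    by (simp add: krasovskii_def)
qed

lemma weak_solution_imp_is_solution:
  assumes "\<And>t. t \<ge> 0 \<Longrightarrow> \<mu> t \<in> compact_prob_measures" and "\<mu> 0 = \<mu>0"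
    and "weak_continuity_equation (controlled_velocity a \<omega> u \<mu>) \<mu>"
  shows "is_solution a \<omega> u \<mu>0 \<mu>"
  unfolding is_solution_def using assms
  by (intro conjI exI[of _ "controlled_velocity a \<omega> u \<mu>"]) (auto simp: in_krasovskii)

end

theory Submission
  imports Defs
begin

text \<open>
  The flow is treated without characteristics, by testing the continuity equation with two kinds
  of functions. First, along \<open>\<xi>[\<mu>]\<close> the integral of any convex Lipschitz function \<open>\<phi>\<close> of
  \<open>e \<bullet> x\<close> does not increase, because the kernel is an antisymmetric attraction. If \<open>\<phi>\<close> vanishes on a
  halfspace containing \<open>\<omega>\<close>, the control does not contribute, so the support never leaves the
  halfspace. Hence all of \<open>supp \<mu>(t)\<close> stays within distance \<open>R\<close> of each point of \<open>\<omega>\<close>, and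
  \<open>|\<xi>[\<mu>(t)]| \<le> \<epsilon> < M\<close> on \<open>\<omega>\<close> for all times, without any bootstrap in time. Secondly, by
  compactness \<open>supp \<mu>\<^sub>0\<close> lies in balls of a smaller radius \<open>\<rho> < r\<close>; a sum of radial cutoffs that
  are \<open>1\<close> on these balls and decrease to \<open>0\<close> strictly inside the balls of radius \<open>r\<close> has its
  gradient pointing inwards, where the velocity is dominated by the control, so its integral
  keeps its maximal value \<open>1\<close>.

  Krasovskii velocities need not be computed at the discontinuities of the control: the gradients
  of both test functions vanish there.
\<close>

section \<open>Supports of measures, and Krasovskii sets at points of continuity\<close>

text \<open>The complement of the support is covered by the null members of a countable basis, so it
  is null itself.\<close>

lemma AE_in_measure_support:
  fixes \<mu> :: "'a::second_countable_topology measure"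
  assumes "sets \<mu> = sets borel"
  shows "AE x in \<mu>. x \<in> measure_support \<mu>"
proof -
  obtain B :: "'a set set" where B: "countable B" "topological_basis B"
    using ex_countable_basis by blast
  define B0 where "B0 = {U \<in> B. emeasure \<mu> U = 0}"
  have "U \<in> null_sets \<mu>" if "U \<in> B0" for U
    using that topological_basis_open[OF B(2)] assms by (auto simp: B0_def null_sets_def)
  then have "AE x in \<mu>. \<forall>U\<in>B0. x \<notin> U"
    using B(1) by (subst AE_ball_countable) (auto simp: B0_def intro: AE_not_in)
  moreover have "x \<in> measure_support \<mu>" if x: "\<forall>U\<in>B0. x \<notin> U" for x
    unfolding measure_support_def
  proof (clarify)
    fix V assume "open V" "x \<in> V"
    then obtain U where U: "U \<in> B" "x \<in> U" "U \<subseteq> V"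
      using topological_basisE[OF B(2)] by metis
    then have "emeasure \<mu> U > 0"
      using x by (auto simp: B0_def zero_less_iff_neq_zero)
    also have "emeasure \<mu> U \<le> emeasure \<mu> V"
      using U(3) \<open>open V\<close> assms by (intro emeasure_mono) auto
    finally show "emeasure \<mu> V > 0" .
  qed
  ultimately show ?thesis
    by (auto elim: eventually_mono)
qed

text \<open>The complement of \<open>F\<close> is an open null set. Test functions yield almost
  everywhere statements, and this turns them back into inclusions of supports.\<close>

lemma measure_support_subset_closed:
  assumes "closed F" "AE x in \<mu>. x \<in> F" "sets \<mu> = sets borel"
  shows "measure_support \<mu> \<subseteq> F"
proof
  fix x assume x: "x \<in> measure_support \<mu>"
  have "- F \<in> sets \<mu>"
    using assms by auto
  then have "emeasure \<mu> (- F) = 0"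
    using assms(2) by (subst AE_iff_measurable[symmetric, where P = "\<lambda>x. x \<in> F"])
      (auto simp: sets_eq_imp_space_eq[OF assms(3)])
  with x assms(1) show "x \<in> F"
    by (auto simp: measure_support_def open_Compl)
qed

lemma compact_prob_measuresD:
  assumes "\<mu> \<in> compact_prob_measures"
  shows "prob_space \<mu>" "sets \<mu> = sets borel" "compact (measure_support \<mu>)"
    "AE x in \<mu>. x \<in> measure_support \<mu>"
  using assms AE_in_measure_support[of \<mu>]
  by (auto simp: compact_prob_measures_def)

text \<open>Small balls around a point of continuity are mapped into an arbitrarily small closed
  ball around \<open>v x\<close>, which is convex. This determines the transporting velocity
  wherever the gradients used below are nonzero.\<close>

lemma krasovskii_isCont:
  assumes "isCont v x"
  shows "krasovskii v x \<subseteq> {v x}"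
proof
  fix y assume y: "y \<in> krasovskii v x"
  have "dist (v x) y \<le> e" if e: "e > 0" for e
  proof -
    obtain d where d: "d > 0" "\<And>z. dist z x < d \<Longrightarrow> dist (v z) (v x) < e"
      using assms e unfolding continuous_at_eps_delta by metis
    have "v ` ball x d \<subseteq> cball (v x) e"
      using d(2) by (force simp: dist_commute)
    then have "closure (convex hull (v ` ball x d)) \<subseteq> cball (v x) e"
      by (intro closure_minimal hull_minimal) auto
    then show ?thesis
      using y d(1) unfolding krasovskii_def by fastforce
  qed
  then have "dist (v x) y \<le> 0"
    by (rule field_le_epsilon) simp
  then show "y \<in> {v x}"
    by simp
qed

section \<open>Continuously differentiable cutoffs\<close>

lemma DERIV_max_0_power2:
  "((\<lambda>s::real. (max 0 s)\<^sup>2) has_real_derivative 2 * max 0 s) (at s)"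
proof (cases s "0::real" rule: linorder_cases)
  case less
  have "((\<lambda>s::real. 0) has_real_derivative 0) (at s)" by simp
  then have "((\<lambda>s::real. (max 0 s)\<^sup>2) has_real_derivative 0) (at s)"
    by (rule DERIV_cong_ev[THEN iffD1, rotated 3])
      (use less eventually_nhds_in_open[of "{..<0}" s] in \<open>auto elim!: eventually_mono\<close>)
  then show ?thesis using less by simp
next
  case equal
  have "((\<lambda>h::real. (max 0 h)\<^sup>2 / h) \<longlongrightarrow> 0) (at 0)"
  proof (rule Lim_null_comparison)
    show "\<forall>\<^sub>F h in at (0::real). norm ((max 0 h)\<^sup>2 / h) \<le> \<bar>h\<bar>"
      by (intro always_eventually) (auto simp: max_def power2_eq_square)
    show "((\<lambda>h::real. \<bar>h\<bar>) \<longlongrightarrow> 0) (at 0)"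
      by (intro tendsto_eq_intros) auto
  qed
  with equal show ?thesis by (simp add: DERIV_def)
next
  case greater
  have "((\<lambda>s::real. s\<^sup>2) has_real_derivative 2 * s) (at s)"
    by (auto intro!: derivative_eq_intros)
  then have "((\<lambda>s::real. (max 0 s)\<^sup>2) has_real_derivative 2 * s) (at s)"
    by (rule DERIV_cong_ev[THEN iffD1, rotated 3])
      (use greater eventually_nhds_in_open[of "{0<..}" s] in \<open>auto elim!: eventually_mono\<close>)
  then show ?thesis using greater by simp
qed

text \<open>Nesting two squared positive parts gives a nonincreasing C^1 profile that is
  \<open>1\<close> up to \<open>b - 1\<close> and \<open>0\<close> from \<open>b\<close> on. Other
  transition lengths are obtained by scaling the argument.\<close>

definition cutoff :: "real \<Rightarrow> real \<Rightarrow> real" where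
  "cutoff b s = 1 - (max 0 (1 - (max 0 (b - s))\<^sup>2))\<^sup>2"

definition cutoff_deriv :: "real \<Rightarrow> real \<Rightarrow> real" where
  "cutoff_deriv b s = - 4 * max 0 (1 - (max 0 (b - s))\<^sup>2) * max 0 (b - s)"

lemma DERIV_cutoff: "(cutoff b has_real_derivative cutoff_deriv b s) (at s)"
proof -
  have "((\<lambda>s. (max 0 (b - s))\<^sup>2) has_real_derivative 2 * max 0 (b - s) * (- 1)) (at s)"
    by (rule DERIV_chain2[OF DERIV_max_0_power2]) (auto intro!: derivative_eq_intros)
  from DERIV_diff[OF DERIV_const this, of 1]
  have "((\<lambda>s. 1 - (max 0 (b - s))\<^sup>2) has_real_derivative 2 * max 0 (b - s)) (at s)"
    by simp
  from DERIV_diff[OF DERIV_const DERIV_chain2[OF DERIV_max_0_power2 this], of 1]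
  have "((\<lambda>s. 1 - (max 0 (1 - (max 0 (b - s))\<^sup>2))\<^sup>2) has_real_derivative
      - (2 * max 0 (1 - (max 0 (b - s))\<^sup>2) * (2 * max 0 (b - s)))) (at s)"
    by simp
  then show ?thesis
    unfolding cutoff_def[abs_def] cutoff_deriv_def by (simp add: mult.assoc)
qed

lemma continuous_on_cutoff_deriv [continuous_intros]:
  "continuous_on A f \<Longrightarrow> continuous_on A (\<lambda>x. cutoff_deriv b (f x))"
  unfolding cutoff_deriv_def by (intro continuous_intros)

lemma cutoff_nonneg: "0 \<le> cutoff b s"
  unfolding cutoff_def by (auto intro!: power_le_one)

lemma cutoff_le_1: "cutoff b s \<le> 1"
  unfolding cutoff_def by simp

lemma cutoff_eq_1: "s \<le> b - 1 \<Longrightarrow> cutoff b s = 1"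
  using one_le_power[of "b - s" 2] unfolding cutoff_def by simp

lemma cutoff_eq_0: "b \<le> s \<Longrightarrow> cutoff b s = 0"
  unfolding cutoff_def by simp

lemma cutoff_deriv_nonpos: "cutoff_deriv b s \<le> 0"
  unfolding cutoff_deriv_def by simp

lemma cutoff_deriv_eq_0:
  assumes "s \<le> b - 1 \<or> b \<le> s"
  shows "cutoff_deriv b s = 0"
  using assms one_le_power[of "b - s" 2] unfolding cutoff_deriv_def by auto

lemma abs_cutoff_deriv_le: "\<bar>cutoff_deriv b s\<bar> \<le> 4"
proof (cases "s \<le> b - 1 \<or> b \<le> s")
  case False
  then have "max 0 (1 - (max 0 (b - s))\<^sup>2) * max 0 (b - s) \<le> 1 * 1"
    by (intro mult_mono) auto
  then show ?thesis
    by (simp add: cutoff_deriv_def abs_mult)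
qed (simp add: cutoff_deriv_eq_0)

text \<open>Composing with the squared norm avoids the singularity of the norm at the centre
  \<open>p\<close>.\<close>

lemma GDERIV_cutoff_norm:
  fixes p :: "'a::real_inner"
  shows "GDERIV (\<lambda>y. cutoff b (k * (norm (y - p))\<^sup>2)) y :>
    (cutoff_deriv b (k * (norm (y - p))\<^sup>2) * (2 * k)) *\<^sub>R (y - p)"
proof -
  have "GDERIV (\<lambda>y. k * (norm (y - p))\<^sup>2) y :> (2 * k) *\<^sub>R (y - p)"
    unfolding gderiv_def power2_norm_eq_inner
    by (auto intro!: derivative_eq_intros simp: inner_commute algebra_simps)
  from GDERIV_DERIV_compose[OF this DERIV_cutoff] show ?thesis
    by simp
qed

lemma continuous_on_cutoff_gradient:
  fixes p :: "'a::real_inner"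
  shows "continuous_on A (\<lambda>y. (cutoff_deriv b (k * (norm (y - p))\<^sup>2) * (2 * k)) *\<^sub>R (y - p))"
  by (intro continuous_intros)

section \<open>Test functions of linear growth\<close>

lemma GDERIV_imp_continuous_on:
  assumes "\<And>x. GDERIV \<phi> x :> g x"
  shows "continuous_on A \<phi>"
  using assms unfolding gderiv_def
  by (meson continuous_at_imp_continuous_on has_derivative_continuous)

text \<open>The test function need not have compact support: it is truncated at radius \<open>m\<close> with gradients
  bounded uniformly in \<open>m\<close>. Since each \<open>\<mu> s\<close> has compact support, at fixed \<open>s\<close> the truncation
  is eventually invisible. Only the positive part of the derivative is passed to the limit, so
  that the limit is \<open>0\<close> and measurability in \<open>s\<close> of the untruncated integral is not an issue.\<close>
lemma weak_continuity_linear_growth: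
  fixes w :: "real \<Rightarrow> 'a::euclidean_space \<Rightarrow> 'a"
  assumes w: "weak_continuity_equation w \<mu>"
    and \<mu>: "\<And>t. t \<ge> 0 \<Longrightarrow> \<mu> t \<in> compact_prob_measures"
    and \<phi>: "\<And>x. GDERIV \<phi> x :> g x" "continuous_on UNIV g"
    and C: "\<And>x. norm (g x) \<le> C" "\<And>x. \<bar>\<phi> x\<bar> \<le> C * (1 + norm x)"
    and nonpos: "AE s in lborel. 0 \<le> s \<longrightarrow> (LINT x|\<mu> s. g x \<bullet> w s x) \<le> 0"
    and t: "t \<ge> 0"
  shows "(LINT x|\<mu> t. \<phi> x) \<le> (LINT x|\<mu> 0. \<phi> x)"
proof -
  have C0: "C \<ge> 0"
    using norm_ge_zero order_trans C(1) by blast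
  define m where "m k = real (Suc k)" for k
  \<comment> \<open>Level \<open>2\<close> and scale \<open>1 / (m k)\<^sup>2\<close> make
    \<open>\<eta> k\<close> equal to \<open>1\<close> for norms up to \<open>m k\<close> and to
    \<open>0\<close> for norms from \<open>2 * m k\<close> on. The subtracted \<open>0\<close> is
    the centre in \<open>GDERIV_cutoff_norm\<close>.\<close>
  define \<eta> where "\<eta> k x = cutoff 2 (1 / (m k)\<^sup>2 * (norm (x - 0))\<^sup>2)" for k and x :: 'a
  define \<eta>' where "\<eta>' k x = (cutoff_deriv 2 (1 / (m k)\<^sup>2 * (norm (x - 0))\<^sup>2) * (2 * (1 / (m k)\<^sup>2))) *\<^sub>R (x - 0)"
    for k and x :: 'a
  define \<Phi> where "\<Phi> k x = \<phi> x * \<eta> k x" for k x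
  define G where "G k x = \<phi> x *\<^sub>R \<eta>' k x + \<eta> k x *\<^sub>R g x" for k x
  define f where "f k s = (LINT x|\<mu> s. G k x \<bullet> w s x)" for k s
  have m: "m k \<ge> 1" for k
    by (simp add: m_def)
  have \<eta>_deriv: "GDERIV (\<eta> k) x :> \<eta>' k x" for k x
    unfolding \<eta>_def[abs_def] \<eta>'_def by (rule GDERIV_cutoff_norm)
  have \<eta>'_cont: "continuous_on UNIV (\<eta>' k)" for k
    unfolding \<eta>'_def[abs_def] by (rule continuous_on_cutoff_gradient)
  have \<eta>_near: "\<eta> k x = 1" "\<eta>' k x = 0" if "norm x \<le> m k" for k x
  proof -
    have "(norm x)\<^sup>2 \<le> (m k)\<^sup>2"
      using that by (intro power_mono) auto
    then have "1 / (m k)\<^sup>2 * (norm (x - 0))\<^sup>2 \<le> 2 - 1"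
      using m[of k] by (simp add: divide_simps)
    then show "\<eta> k x = 1" "\<eta>' k x = 0"
      by (simp_all add: \<eta>_def \<eta>'_def cutoff_eq_1 cutoff_deriv_eq_0)
  qed
  have \<eta>_far: "\<eta> k x = 0" "\<eta>' k x = 0" if "norm x \<ge> 2 * m k" for k x
  proof -
    have "2 * (m k)\<^sup>2 \<le> (2 * m k)\<^sup>2"
      by (simp add: power_mult_distrib)
    also have "\<dots> \<le> (norm x)\<^sup>2"
      using that m[of k] by (intro power_mono) auto
    finally have "2 \<le> 1 / (m k)\<^sup>2 * (norm (x - 0))\<^sup>2"
      using m[of k] by (simp add: divide_simps)
    then show "\<eta> k x = 0" "\<eta>' k x = 0"
      by (simp_all add: \<eta>_def \<eta>'_def cutoff_eq_0 cutoff_deriv_eq_0)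
  qed
  have \<Phi>_deriv: "GDERIV (\<Phi> k) x :> G k x" for k x
    unfolding \<Phi>_def[abs_def] G_def using GDERIV_mult[OF \<phi>(1) \<eta>_deriv] by simp
  have G_cont: "continuous_on UNIV (G k)" for k
    unfolding G_def[abs_def]
    by (intro continuous_intros GDERIV_imp_continuous_on[OF \<phi>(1)]
        GDERIV_imp_continuous_on[OF \<eta>_deriv] \<eta>'_cont \<phi>(2))
  have "{x. \<Phi> k x \<noteq> 0} \<subseteq> cball 0 (2 * m k)" for k
    using \<eta>_far(1)[of k] by (force simp: \<Phi>_def)
  then have \<Phi>_supp: "compact (closure {x. \<Phi> k x \<noteq> 0})" for k
    by (meson bounded_cball bounded_subset compact_closure)
  \<comment> \<open>Where \<open>\<eta>' k\<close> is nonzero, \<open>\<phi>\<close> is at most of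
    order \<open>m k\<close> and \<open>\<eta>' k\<close> of order \<open>1 / m k\<close>, so the
    product is bounded uniformly in \<open>k\<close>. The constant is
    \<open>3 * 4 * 2 * 2 = 48\<close>, where \<open>3\<close> comes from
    \<open>1 + 2 * m k \<le> 3 * m k\<close>; the term with \<open>g\<close> adds
    \<open>1\<close>.\<close>
  have G_bound: "norm (G k x) \<le> 49 * C" for k x
  proof -
    have "norm (\<phi> x *\<^sub>R \<eta>' k x) \<le> 48 * C"
    proof (cases "norm x \<ge> 2 * m k")
      case True
      then show ?thesis using \<eta>_far C0 by simp
    next
      case False
      have "norm (\<phi> x *\<^sub>R \<eta>' k x) = \<bar>\<phi> x\<bar> *
          (\<bar>cutoff_deriv 2 (1 / (m k)\<^sup>2 * (norm (x - 0))\<^sup>2)\<bar> * (2 / (m k)\<^sup>2) * norm x)"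
        by (simp add: \<eta>'_def abs_mult)
      also have "\<dots> \<le> (C * (1 + 2 * m k)) * (4 * (2 / (m k)\<^sup>2) * (2 * m k))"
        using False C0 m[of k] abs_cutoff_deriv_le
        by (intro mult_mono order_trans[OF C(2)] mult_left_mono) auto
      also have "\<dots> \<le> (C * (3 * m k)) * (4 * (2 / (m k)\<^sup>2) * (2 * m k))"
        using C0 m[of k] by (intro mult_right_mono mult_left_mono) auto
      also have "\<dots> = 48 * C"
        using m[of k] by (simp add: power2_eq_square)
      finally show ?thesis .
    qed
    moreover have "norm (\<eta> k x *\<^sub>R g x) \<le> 1 * C"
      unfolding norm_scaleR using C(1) C0
      by (intro mult_mono) (auto simp: \<eta>_def cutoff_nonneg cutoff_le_1)
    ultimately show ?thesis
      unfolding G_def by (intro order_trans[OF norm_triangle_ineq]) auto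
  qed
  have AE_near: "\<forall>\<^sub>F k in sequentially. AE x in \<mu> s. norm x \<le> m k" if "s \<ge> 0" for s
  proof -
    note D = compact_prob_measuresD[OF \<mu>[OF that]]
    obtain b where b: "\<And>x. x \<in> measure_support (\<mu> s) \<Longrightarrow> norm x \<le> b"
      using compact_imp_bounded[OF D(3)] by (auto simp: bounded_iff)
    obtain n where n: "b \<le> real n"
      using real_arch_simple by blast
    have "AE x in \<mu> s. norm x \<le> m k" if "k \<ge> n" for k
      using D(4) by eventually_elim (use b n that in \<open>fastforce simp: m_def\<close>)
    then show ?thesis
      by (auto simp: eventually_sequentially)
  qed
  have meas: "h \<in> borel_measurable (\<mu> s)" if "continuous_on UNIV h" "s \<ge> 0"
    for h :: "'a \<Rightarrow> real" and s
    using that compact_prob_measuresD(2)[OF \<mu>[OF that(2)]]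
    by (simp add: borel_measurable_continuous_onI cong: measurable_cong_sets)
  have \<Phi>_int: "\<forall>\<^sub>F k in sequentially. (LINT x|\<mu> s. \<Phi> k x) = (LINT x|\<mu> s. \<phi> x)" if "s \<ge> 0" for s
    using AE_near[OF that]
  proof eventually_elim
    case (elim k)
    show ?case
    proof (rule integral_cong_AE)
      show "\<Phi> k \<in> borel_measurable (\<mu> s)" "\<phi> \<in> borel_measurable (\<mu> s)"
        by (rule meas[OF GDERIV_imp_continuous_on[OF \<Phi>_deriv] that]
            meas[OF GDERIV_imp_continuous_on[OF \<phi>(1)] that])+
      show "AE x in \<mu> s. \<Phi> k x = \<phi> x"
        using elim by eventually_elim (simp add: \<Phi>_def \<eta>_near)
    qed
  qed
  have f_nonpos: "AE s in lborel. 0 \<le> s \<longrightarrow> (\<forall>\<^sub>F k in sequentially. f k s \<le> 0)"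
    using nonpos w[unfolded weak_continuity_equation_def, THEN conjunct1]
  proof eventually_elim
    case (elim s)
    show ?case
    proof
      assume s: "0 \<le> s"
      have sets: "sets (\<mu> s) = sets borel"
        by (rule compact_prob_measuresD(2)[OF \<mu>[OF s]])
      have [measurable]: "w s \<in> borel_measurable (\<mu> s)"
        using elim(2) s by auto
      have [measurable]: "g \<in> borel_measurable (\<mu> s)" "G k \<in> borel_measurable (\<mu> s)" for k
        using \<phi>(2) G_cont sets by (simp_all add: borel_measurable_continuous_onI cong: measurable_cong_sets)
      show "\<forall>\<^sub>F k in sequentially. f k s \<le> 0"
        using AE_near[OF s]
      proof eventually_elim
        case (elim k)
        have "f k s = (LINT x|\<mu> s. g x \<bullet> w s x)"
          unfolding f_def
        proof (rule integral_cong_AE)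
          show "AE x in \<mu> s. G k x \<bullet> w s x = g x \<bullet> w s x"
            using elim by eventually_elim (simp add: G_def \<eta>_near)
        qed measurable
        then show ?case
          using \<open>0 \<le> s \<longrightarrow> (LINT x|\<mu> s. g x \<bullet> w s x) \<le> 0\<close> s by simp
      qed
    qed
  qed
  have f_bound: "AE s in lborel. 0 \<le> s \<longrightarrow> (\<forall>k. \<bar>f k s\<bar> \<le> 49 * C * (LINT x|\<mu> s. norm (w s x)))"
    using w[unfolded weak_continuity_equation_def, THEN conjunct1]
  proof eventually_elim
    case (elim s)
    show ?case
    proof (intro impI allI)
      fix k assume s: "0 \<le> s"
      have "\<bar>f k s\<bar> \<le> (LINT x|\<mu> s. \<bar>G k x \<bullet> w s x\<bar>)"
        unfolding f_def using integral_norm_bound[of "\<mu> s" "\<lambda>x. G k x \<bullet> w s x"] by simp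
      also have "\<dots> \<le> (LINT x|\<mu> s. 49 * C * norm (w s x))"
      proof (rule integral_mono')
        show "\<bar>G k x \<bullet> w s x\<bar> \<le> 49 * C * norm (w s x)" for x
          by (rule order_trans[OF Cauchy_Schwarz_ineq2]) (intro mult_right_mono G_bound norm_ge_zero)
      qed (use elim s C0 in auto)
      finally show "\<bar>f k s\<bar> \<le> 49 * C * (LINT x|\<mu> s. norm (w s x))"
        by simp
    qed
  qed
  have eqn: "set_integrable lborel {0..t} (f k)"
    "(LINT x|\<mu> t. \<Phi> k x) = (LINT x|\<mu> 0. \<Phi> k x) + (LINT s:{0..t}|lborel. f k s)" for k
    using w \<Phi>_deriv G_cont \<Phi>_supp t unfolding weak_continuity_equation_def f_def by blast+
  define F where "F k s = max 0 (indicator {0..t} s *\<^sub>R f k s)" for k s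
  have F_int: "integrable lborel (F k)" for k
    using eqn(1)[of k] unfolding set_integrable_def F_def by (intro integrable_max) auto
  \<comment> \<open>The index from which \<open>f k s \<le> 0\<close> holds depends on
    \<open>s\<close>, so the limit is taken by dominated convergence, with the norm of the velocity
    as majorant.\<close>
  have "(\<lambda>k. integral\<^sup>L lborel (F k)) \<longlonglongrightarrow> (LINT s::real|lborel. (0::real))"
  proof (rule integral_dominated_convergence[where
        w = "\<lambda>s. 49 * C * (indicator {0..t} s *\<^sub>R (LINT x|\<mu> s. norm (w s x)))"])
    have "set_integrable lborel {0..t} (\<lambda>s. LINT x|\<mu> s. norm (w s x))"
      using w t unfolding weak_continuity_equation_def by blast
    then show "integrable lborel (\<lambda>s. 49 * C * (indicator {0..t} s *\<^sub>R (LINT x|\<mu> s. norm (w s x))))"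
      unfolding set_integrable_def by simp
    show "AE s in lborel. (\<lambda>k. F k s) \<longlonglongrightarrow> 0"
      using f_nonpos
    proof eventually_elim
      case (elim s)
      show ?case
      proof (cases "s \<in> {0..t}")
        case True
        then have "\<forall>\<^sub>F k in sequentially. f k s \<le> 0"
          using elim by simp
        then have "\<forall>\<^sub>F k in sequentially. F k s = 0"
          by eventually_elim (use True in \<open>simp add: F_def indicator_def\<close>)
        then show ?thesis by (rule tendsto_eventually)
      qed (simp add: F_def)
    qed
    show "AE s in lborel. norm (F k s) \<le> 49 * C * (indicator {0..t} s *\<^sub>R (LINT x|\<mu> s. norm (w s x)))" for k
      using f_bound
    proof eventually_elim
      case (elim s)
      show ?case
      proof (cases "s \<in> {0..t}")
        case True
        then have "\<bar>f k s\<bar> \<le> 49 * C * (LINT x|\<mu> s. norm (w s x))"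
          using elim by simp
        then show ?thesis using True C0 by (auto simp: F_def indicator_def)
      qed (simp add: F_def)
    qed
  qed (use F_int in auto)
  then have lim: "(\<lambda>k. (LINT x|\<mu> 0. \<phi> x) + integral\<^sup>L lborel (F k)) \<longlonglongrightarrow> (LINT x|\<mu> 0. \<phi> x)"
    by (auto intro!: tendsto_eq_intros)
  have "\<forall>\<^sub>F k in sequentially. (LINT x|\<mu> t. \<phi> x) \<le> (LINT x|\<mu> 0. \<phi> x) + integral\<^sup>L lborel (F k)"
    using \<Phi>_int[OF t] \<Phi>_int[OF order_refl]
  proof eventually_elim
    case (elim k)
    have "(LINT s:{0..t}|lborel. f k s) \<le> integral\<^sup>L lborel (F k)"
      unfolding set_lebesgue_integral_def using eqn(1)[of k] F_int[of k]
      by (intro integral_mono) (auto simp: set_integrable_def F_def)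
    then show ?case
      using eqn(2)[of k] elim by simp
  qed
  then show ?thesis
    by (intro tendsto_lowerbound[OF lim]) auto
qed

section \<open>The interaction field\<close>

text \<open>With general \<open>f\<close> and \<open>g\<close>, one statement serves both for
  continuity in a single variable and for joint continuity on a product.\<close>

lemma continuous_on_interaction_kernel:
  fixes f g :: "'b::topological_space \<Rightarrow> 'a::real_normed_vector"
  assumes "continuous_on {0..} a" "continuous_on A f" "continuous_on A g"
  shows "continuous_on A (\<lambda>p. a (norm (f p - g p)) *\<^sub>R (g p - f p))"
proof -
  have "continuous_on A (\<lambda>p. norm (f p - g p))"
    by (intro continuous_on_norm continuous_on_diff assms)
  then have "continuous_on A (\<lambda>p. a (norm (f p - g p)))"
    by (rule continuous_on_compose2[OF assms(1)]) auto
  then show ?thesis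
    by (intro continuous_on_scaleR continuous_on_diff assms)
qed

lemma interaction_kernel_bounded:
  fixes X Y :: "'a::euclidean_space set"
  assumes "continuous_on {0..} a" "compact X" "compact Y"
  shows "\<exists>B. \<forall>x\<in>X. \<forall>y\<in>Y. norm (a (norm (x - y)) *\<^sub>R (y - x)) \<le> B"
proof -
  have "compact ((\<lambda>p. a (norm (fst p - snd p)) *\<^sub>R (snd p - fst p)) ` (X \<times> Y))"
    by (intro compact_continuous_image continuous_on_interaction_kernel[OF assms(1)]
        continuous_on_fst continuous_on_snd continuous_on_id compact_Times assms(2,3))
  from this[THEN compact_imp_bounded, unfolded bounded_iff]
  obtain B where B: "\<forall>z \<in> (\<lambda>p. a (norm (fst p - snd p)) *\<^sub>R (snd p - fst p)) ` (X \<times> Y). norm z \<le> B" ..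
  show ?thesis
  proof (intro exI ballI)
    fix x y assume "x \<in> X" "y \<in> Y"
    then show "norm (a (norm (x - y)) *\<^sub>R (y - x)) \<le> B"
      by (intro B[rule_format] image_eqI[of _ _ "(x, y)"]) auto
  qed
qed

lemma integrable_continuous_compact_prob:
  fixes f :: "'a::euclidean_space \<Rightarrow> 'b::{banach, second_countable_topology}"
  assumes "continuous_on UNIV f" "\<mu> \<in> compact_prob_measures"
  shows "integrable \<mu> f"
proof -
  note D = compact_prob_measuresD[OF assms(2)]
  interpret prob_space \<mu> by (rule D)
  have "compact (f ` measure_support \<mu>)"
    using assms(1) continuous_on_subset by (intro compact_continuous_image D(3)) auto
  from this[THEN compact_imp_bounded, unfolded bounded_iff]
  obtain B where B: "\<forall>z \<in> f ` measure_support \<mu>. norm z \<le> B" ..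
  show ?thesis
  proof (rule integrable_const_bound)
    show "AE y in \<mu>. norm (f y) \<le> B"
      using D(4) by eventually_elim (use B in auto)
    show "f \<in> borel_measurable \<mu>"
      using D(2) assms(1) by (simp add: borel_measurable_continuous_onI cong: measurable_cong_sets)
  qed
qed

lemma interaction_kernel_integrable:
  fixes \<mu> :: "'a::euclidean_space measure"
  assumes "continuous_on {0..} a" "\<mu> \<in> compact_prob_measures"
  shows "integrable \<mu> (\<lambda>y. a (norm (x - y)) *\<^sub>R (y - x))"
  by (intro integrable_continuous_compact_prob assms(2)
      continuous_on_interaction_kernel[OF assms(1)] continuous_on_const continuous_on_id)

text \<open>Dominated convergence along a sequence: together with its limit the sequence is compact,
  so the kernel is bounded uniformly on it and on the support. Thus only the control can make the
  velocity discontinuous.\<close>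

lemma isCont_interaction_field:
  fixes \<mu> :: "'a::euclidean_space measure"
  assumes "continuous_on {0..} a" "\<mu> \<in> compact_prob_measures"
  shows "isCont (interaction_field a \<mu>) x"
  unfolding continuous_at_sequentially comp_def interaction_field_def
proof (intro allI impI)
  fix X assume X: "X \<longlonglongrightarrow> x"
  note D = compact_prob_measuresD[OF assms(2)]
  interpret prob_space \<mu> by (rule D)
  have "compact (insert x (range X))"
    using X by (rule compact_sequence_with_limit)
  from interaction_kernel_bounded[OF assms(1) this D(3)] obtain B where
    B: "\<forall>z\<in>insert x (range X). \<forall>y\<in>measure_support \<mu>. norm (a (norm (z - y)) *\<^sub>R (y - z)) \<le> B" ..
  show "(\<lambda>n. LINT y|\<mu>. a (norm (X n - y)) *\<^sub>R (y - X n)) \<longlonglongrightarrow> (LINT y|\<mu>. a (norm (x - y)) *\<^sub>R (y - x))"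
  proof (rule integral_dominated_convergence[where w = "\<lambda>_. B"])
    show "AE y in \<mu>. norm (a (norm (X n - y)) *\<^sub>R (y - X n)) \<le> B" for n
      using D(4) by eventually_elim (use B in auto)
    show "AE y in \<mu>. (\<lambda>n. a (norm (X n - y)) *\<^sub>R (y - X n)) \<longlonglongrightarrow> a (norm (x - y)) *\<^sub>R (y - x)"
    proof (rule AE_I2)
      fix y :: 'a
      have "continuous_on UNIV (\<lambda>z. a (norm (z - y)) *\<^sub>R (y - z))"
        by (intro continuous_on_interaction_kernel[OF assms(1)] continuous_on_const continuous_on_id)
      then show "(\<lambda>n. a (norm (X n - y)) *\<^sub>R (y - X n)) \<longlonglongrightarrow> a (norm (x - y)) *\<^sub>R (y - x)"
        by (rule continuous_on_tendsto_compose[OF _ X]) auto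
    qed
  qed (use interaction_kernel_integrable[OF assms] in auto)
qed

lemma norm_interaction_field_le:
  fixes \<mu> :: "'a::euclidean_space measure"
  assumes "continuous_on {0..} a" "\<mu> \<in> compact_prob_measures"
    and "AE y in \<mu>. \<bar>a (norm (x - y))\<bar> * norm (x - y) \<le> b"
  shows "norm (interaction_field a \<mu> x) \<le> b"
proof -
  note D = compact_prob_measuresD[OF assms(2)]
  interpret prob_space \<mu> by (rule D)
  have "norm (interaction_field a \<mu> x) \<le> (LINT y|\<mu>. norm (a (norm (x - y)) *\<^sub>R (y - x)))"
    unfolding interaction_field_def by (rule integral_norm_bound)
  also have "\<dots> \<le> (LINT y|\<mu>. b)"
  proof (rule integral_mono_AE)
    show "integrable \<mu> (\<lambda>y. norm (a (norm (x - y)) *\<^sub>R (y - x)))"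
      by (intro integrable_norm interaction_kernel_integrable assms)
    show "AE y in \<mu>. norm (a (norm (x - y)) *\<^sub>R (y - x)) \<le> b"
      using assms(3) by (simp add: norm_minus_commute)
  qed simp
  finally show ?thesis by (simp add: prob_space)
qed

text \<open>A function that is not integrable has integral \<open>0\<close>, so the sign is correct
  in that case too.\<close>

lemma integral_nonpos_AE:
  fixes f :: "'a \<Rightarrow> real"
  assumes "AE x in M. f x \<le> 0"
  shows "integral\<^sup>L M f \<le> 0"
  using integral_nonneg_AE[where M = M and f = "\<lambda>x. - f x"] assms by simp

text \<open>Exchanging \<open>x\<close> and \<open>y\<close> turns twice the integral into that of
  \<open>(G (e \<bullet> x) - G (e \<bullet> y)) * a (norm (x - y)) * (e \<bullet> (y - x))\<close>.\<close>
lemma interaction_field_dissipative: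
  fixes \<mu> :: "'a::euclidean_space measure"
  assumes a: "continuous_on {0..} a" "\<And>s. s \<ge> 0 \<Longrightarrow> a s \<ge> 0"
    and \<mu>: "\<mu> \<in> compact_prob_measures"
    and G: "continuous_on UNIV G" "mono G"
  shows "(LINT x|\<mu>. G (e \<bullet> x) * (e \<bullet> interaction_field a \<mu> x)) \<le> 0"
proof -
  note D = compact_prob_measuresD[OF \<mu>]
  interpret prob_space \<mu> by (rule D)
  interpret P: pair_prob_space \<mu> \<mu> ..
  define k where "k x y = G (e \<bullet> x) * (e \<bullet> (a (norm (x - y)) *\<^sub>R (y - x)))" for x y
  have cont: "continuous_on A (\<lambda>p. k (fst p) (snd p))" for A
    unfolding k_def
    by (intro continuous_on_mult continuous_on_inner continuous_on_const
        continuous_on_interaction_kernel[OF a(1)] continuous_on_fst continuous_on_snd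
        continuous_on_id continuous_on_compose2[OF G(1)]) auto
  have sets: "sets (\<mu> \<Otimes>\<^sub>M \<mu>) = sets borel"
    using D(2) by (metis borel_prod sets_pair_measure_cong)
  have meas: "(\<lambda>p. k (fst p) (snd p)) \<in> borel_measurable (\<mu> \<Otimes>\<^sub>M \<mu>)"
    using cont sets by (simp add: borel_measurable_continuous_onI cong: measurable_cong_sets)
  have supp: "measure_support \<mu> \<times> measure_support \<mu> \<in> sets (\<mu> \<Otimes>\<^sub>M \<mu>)"
    unfolding sets using D(3) by (intro borel_compact compact_Times)
  \<comment> \<open>Fubini requires integrability over the product measure: \<open>k\<close> is
    bounded on the compact product of the supports, which carries all the mass.\<close>
  have AE2: "AE p in \<mu> \<Otimes>\<^sub>M \<mu>. p \<in> measure_support \<mu> \<times> measure_support \<mu>"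
  proof (rule P.AE_pair_measure)
    show "{p \<in> space (\<mu> \<Otimes>\<^sub>M \<mu>). p \<in> measure_support \<mu> \<times> measure_support \<mu>} \<in> sets (\<mu> \<Otimes>\<^sub>M \<mu>)"
      using supp sets.sets_into_space[OF supp] by (simp add: Int_absorb1 Collect_conj_eq)
    show "AE x in \<mu>. AE y in \<mu>. (x, y) \<in> measure_support \<mu> \<times> measure_support \<mu>"
      using D(4)
    proof eventually_elim
      case (elim x)
      show ?case using D(4) by eventually_elim (use elim in simp)
    qed
  qed
  have "compact ((\<lambda>p. k (fst p) (snd p)) ` (measure_support \<mu> \<times> measure_support \<mu>))"
    by (intro compact_continuous_image cont compact_Times D(3))
  from this[THEN compact_imp_bounded, unfolded bounded_iff]
  obtain B where "\<forall>z \<in> (\<lambda>p. k (fst p) (snd p)) ` (measure_support \<mu> \<times> measure_support \<mu>). norm z \<le> B" ..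
  then have B: "\<bar>k (fst p) (snd p)\<bar> \<le> B" if "p \<in> measure_support \<mu> \<times> measure_support \<mu>" for p
    using that by fastforce
  have int: "integrable (\<mu> \<Otimes>\<^sub>M \<mu>) (\<lambda>(x, y). k x y)"
    unfolding case_prod_beta
    by (rule P.P.integrable_const_bound[OF _ meas, of B])
      (use AE2 B in \<open>auto elim!: eventually_mono\<close>)
  have I: "(LINT x|\<mu>. G (e \<bullet> x) * (e \<bullet> interaction_field a \<mu> x)) = (LINT x|\<mu>. LINT y|\<mu>. k x y)"
    unfolding k_def interaction_field_def
    by (simp only: integral_mult_right_zero
        integral_inner_right[OF interaction_kernel_integrable[OF a(1) \<mu>]])
  have "(LINT x|\<mu>. LINT y|\<mu>. k x y) + (LINT x|\<mu>. LINT y|\<mu>. k x y) =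
      (LINT x|\<mu>. LINT y|\<mu>. k x y) + (LINT x|\<mu>. LINT y|\<mu>. k y x)"
    using P.Fubini_integral[OF int] by simp
  also have "\<dots> = (LINT p|(\<mu> \<Otimes>\<^sub>M \<mu>). (case p of (x, y) \<Rightarrow> k x y)) + (LINT p|(\<mu> \<Otimes>\<^sub>M \<mu>). (case p of (x, y) \<Rightarrow> k y x))"
    using P.integral_fst'[OF int] P.integral_fst'[OF P.integrable_product_swap[OF int]]
    by (simp add: case_prod_beta')
  also have "\<dots> = (LINT p|(\<mu> \<Otimes>\<^sub>M \<mu>). (case p of (x, y) \<Rightarrow> k x y) + (case p of (x, y) \<Rightarrow> k y x))"
    using int P.integrable_product_swap[OF int]
    by (subst Bochner_Integration.integral_add) (auto simp: case_prod_beta)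
  also have "\<dots> \<le> 0"
  proof (rule integral_nonpos_AE, rule AE_I2)
    fix p :: "'a \<times> 'a"
    obtain x y where p: "p = (x, y)" by (cases p)
    \<comment> \<open>The increments of the monotone \<open>G\<close> and of its argument have the
      same sign, so their product is nonnegative.\<close>
    have "k x y + k y x = a (norm (x - y)) * - ((G (e \<bullet> x) - G (e \<bullet> y)) * (e \<bullet> x - e \<bullet> y))"
      unfolding k_def norm_minus_commute[of y x] by (simp add: inner_diff_right algebra_simps)
    also have "\<dots> \<le> 0"
      using a(2)[of "norm (x - y)"] monoD[OF G(2), of "e \<bullet> x" "e \<bullet> y"] monoD[OF G(2), of "e \<bullet> y" "e \<bullet> x"]
      by (intro mult_nonneg_nonpos) (cases "e \<bullet> x \<le> e \<bullet> y"; simp add: mult_nonpos_nonpos)+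
    finally show "(case p of (x, y) \<Rightarrow> k x y) + (case p of (x, y) \<Rightarrow> k y x) \<le> 0"
      by (simp add: p)
  qed
  finally show ?thesis
    unfolding I by simp
qed

text \<open>Continuity is local, so the control term may be replaced by any \<open>f\<close> that
  agrees with it near \<open>x\<close>: the zero field outside a halfspace containing
  \<open>\<omega>\<close>, the radial field inside a punctured ball.\<close>

lemma isCont_controlled_velocity:
  fixes \<mu> :: "real \<Rightarrow> 'a::euclidean_space measure"
  assumes "continuous_on {0..} a" "\<mu> t \<in> compact_prob_measures"
    and "open S" "x \<in> S" "\<And>y. y \<in> S \<Longrightarrow> indicator \<omega> y *\<^sub>R u t y = f y" "isCont f x"
  shows "isCont (controlled_velocity a \<omega> u \<mu> t) x"
proof -
  have "\<forall>\<^sub>F y in nhds x. controlled_velocity a \<omega> u \<mu> t y = interaction_field a (\<mu> t) y + f y"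
    using eventually_nhds_in_open[OF assms(3,4)]
    by eventually_elim (simp add: controlled_velocity_def assms(5))
  then show ?thesis
    by (rule isCont_cong[THEN iffD2]) (intro isCont_add isCont_interaction_field assms)
qed

lemma integral_nonneg_le_0_AE:
  fixes f :: "'a \<Rightarrow> real"
  assumes "integrable M f" "\<And>x. 0 \<le> f x" "integral\<^sup>L M f \<le> 0"
  shows "AE x in M. f x = 0"
proof -
  have "integral\<^sup>L M f = 0"
    using assms(2,3) by (intro antisym integral_nonneg_AE) auto
  then show ?thesis
    using integral_nonneg_eq_0_iff_AE[OF assms(1)] assms(2) by simp
qed

section \<open>Halfspaces that the support cannot leave\<close>

text \<open>The function is the derivative of \<open>sqrt (1 + (max 0 (s - h))\<^sup>2)\<close>, so
  this expresses convexity of the latter. For \<open>p \<ge> 0\<close> the quotient is the root of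
  \<open>p\<^sup>2 / (1 + p\<^sup>2)\<close>, which increases with \<open>p\<close>.\<close>

lemma mono_max_0_div_sqrt: "mono (\<lambda>s::real. max 0 (s - h) / sqrt (1 + (max 0 (s - h))\<^sup>2))"
proof
  fix s s' :: real assume "s \<le> s'"
  define p q where "p = max 0 (s - h)" and "q = max 0 (s' - h)"
  have pq: "0 \<le> p" "p \<le> q"
    using \<open>s \<le> s'\<close> by (auto simp: p_def q_def)
  then have "p\<^sup>2 \<le> q\<^sup>2"
    by (intro power_mono)
  have pos: "0 < 1 + p\<^sup>2" "0 < 1 + q\<^sup>2"
    by (auto intro: add_pos_nonneg)
  have "p / sqrt (1 + p\<^sup>2) = sqrt (p\<^sup>2 / (1 + p\<^sup>2))" "q / sqrt (1 + q\<^sup>2) = sqrt (q\<^sup>2 / (1 + q\<^sup>2))"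
    using pq by (simp_all add: real_sqrt_divide)
  moreover have "p\<^sup>2 / (1 + p\<^sup>2) \<le> q\<^sup>2 / (1 + q\<^sup>2)"
    using pos \<open>p\<^sup>2 \<le> q\<^sup>2\<close> by (simp add: divide_simps algebra_simps)
  ultimately show "p / sqrt (1 + p\<^sup>2) \<le> q / sqrt (1 + q\<^sup>2)"
    by simp
qed

text \<open>The integral of a nonnegative test function that vanishes exactly on the halfspace
  starts at \<open>0\<close> and does not increase, so it remains \<open>0\<close>.\<close>

lemma solution_support_halfspace:
  fixes \<mu> :: "real \<Rightarrow> 'a::euclidean_space measure"
  assumes a: "continuous_on {0..} a" "\<And>s. s \<ge> 0 \<Longrightarrow> a s \<ge> 0"
    and sol: "is_solution a \<omega> u \<mu>0 \<mu>"
    and h: "measure_support \<mu>0 \<subseteq> {x. e \<bullet> x \<le> h}" "\<omega> \<subseteq> {x. e \<bullet> x \<le> h}"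
    and t: "t \<ge> 0"
  shows "measure_support (\<mu> t) \<subseteq> {x. e \<bullet> x \<le> h}"
proof -
  obtain w where w: "weak_continuity_equation w \<mu>"
    and kras: "AE t in lborel. 0 \<le> t \<longrightarrow>
      (AE x in \<mu> t. w t x \<in> krasovskii (controlled_velocity a \<omega> u \<mu> t) x)"
    and \<mu>: "\<And>t. t \<ge> 0 \<Longrightarrow> \<mu> t \<in> compact_prob_measures" and \<mu>0: "\<mu> 0 = \<mu>0"
    using sol unfolding is_solution_def by auto
  define G where "G s = max 0 (s - h) / sqrt (1 + (max 0 (s - h))\<^sup>2)" for s
  define g where "g x = G (e \<bullet> x) *\<^sub>R e" for x
  \<comment> \<open>The square makes \<open>\<phi>\<close> continuously differentiable across the
    boundary of the halfspace; the root keeps its gradient bounded, as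
    \<open>weak_continuity_linear_growth\<close> demands. The single constant \<open>C\<close>
    serves for both the gradient and the growth.\<close>
  define \<phi> where "\<phi> x = sqrt (1 + (max 0 (e \<bullet> x - h))\<^sup>2) - 1" for x
  define C where "C = norm e + \<bar>h\<bar>"
  have pos: "0 < 1 + (max 0 s)\<^sup>2" for s :: real
    by (auto intro: add_pos_nonneg)
  have G_cont: "continuous_on UNIV G"
    unfolding G_def[abs_def] using pos by (intro continuous_intros) (auto simp: less_imp_neq[symmetric])
  have G_bound: "\<bar>G s\<bar> \<le> 1" for s
  proof -
    have "max 0 (s - h) \<le> sqrt (1 + (max 0 (s - h))\<^sup>2)"
      by (rule real_le_rsqrt) simp
    then show ?thesis
      using pos[of "s - h"] by (simp add: G_def abs_mult)
  qed
  have \<phi>_deriv: "GDERIV \<phi> x :> g x" for x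
  proof -
    have "((\<lambda>s. sqrt (1 + (max 0 s)\<^sup>2) - 1) has_real_derivative
        (max 0 s / sqrt (1 + (max 0 s)\<^sup>2))) (at s)" for s
    proof -
      have "((\<lambda>s. 1 + (max 0 s)\<^sup>2) has_real_derivative 2 * max 0 s) (at s)"
        using DERIV_add[OF DERIV_const[of 1] DERIV_max_0_power2[of s]] by simp
      from DERIV_diff[OF DERIV_chain2[OF DERIV_real_sqrt[OF pos] this] DERIV_const[of 1]]
      show ?thesis by (simp add: divide_simps)
    qed
    moreover have "GDERIV (\<lambda>x. e \<bullet> x - h) x :> e"
      unfolding gderiv_def by (auto intro!: derivative_eq_intros simp: inner_commute)
    ultimately show ?thesis
      unfolding \<phi>_def[abs_def] g_def G_def by (rule GDERIV_DERIV_compose[rotated])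
  qed
  have \<phi>_nonneg: "0 \<le> \<phi> x" for x
    by (simp add: \<phi>_def)
  have \<phi>_bound: "\<bar>\<phi> x\<bar> \<le> C * (1 + norm x)" for x
  proof -
    have "sqrt (1 + (max 0 (e \<bullet> x - h))\<^sup>2) \<le> 1 + max 0 (e \<bullet> x - h)"
      by (rule real_le_lsqrt) (auto simp: power2_sum)
    also have "\<dots> \<le> 1 + (norm e * norm x + \<bar>h\<bar>)"
      using Cauchy_Schwarz_ineq2[of e x] by auto
    also have "\<dots> \<le> 1 + C * (1 + norm x)"
      by (simp add: C_def algebra_simps)
    finally show ?thesis
      using \<phi>_nonneg[of x] by (simp add: \<phi>_def)
  qed
  have g_cont: "continuous_on UNIV g"
    unfolding g_def[abs_def]
    by (intro continuous_intros continuous_on_compose2[OF G_cont]) auto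
  have dissip: "AE s in lborel. 0 \<le> s \<longrightarrow> (LINT x|\<mu> s. g x \<bullet> w s x) \<le> 0"
    using kras w[unfolded weak_continuity_equation_def, THEN conjunct1]
  proof eventually_elim
    case (elim s)
    show ?case
    proof
      assume s: "0 \<le> s"
      note D = compact_prob_measuresD[OF \<mu>[OF s]]
      have [measurable]: "w s \<in> borel_measurable (\<mu> s)"
        using elim(2) s by auto
      have [measurable]: "g \<in> borel_measurable (\<mu> s)" "G \<in> borel_measurable borel"
        "(\<lambda>x. e \<bullet> x) \<in> borel_measurable (\<mu> s)" "interaction_field a (\<mu> s) \<in> borel_measurable (\<mu> s)"
        using g_cont D(2) G_cont isCont_interaction_field[OF a(1) \<mu>[OF s]]
        by (simp_all add: borel_measurable_continuous_onI continuous_at_imp_continuous_on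
            continuous_on_inner cong: measurable_cong_sets)
      have "AE x in \<mu> s. w s x \<in> krasovskii (controlled_velocity a \<omega> u \<mu> s) x"
        using elim(1) s by simp
      then have "AE x in \<mu> s. g x \<bullet> w s x = G (e \<bullet> x) * (e \<bullet> interaction_field a (\<mu> s) x)"
      proof eventually_elim
        case (elim x)
        show ?case
        \<comment> \<open>In the closed halfspace the gradient is zero, whatever \<open>w\<close>
          is. Its complement is open and misses \<open>\<omega>\<close>, so there \<open>w\<close>
          is the interaction field.\<close>
        proof (cases "e \<bullet> x \<le> h")
          case True
          then show ?thesis by (simp add: g_def G_def)
        next
          case False
          have "isCont (controlled_velocity a \<omega> u \<mu> s) x"
          proof (rule isCont_controlled_velocity[where S = "{x. h < e \<bullet> x}" and f = "\<lambda>_. 0"])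
            show "open {x. h < e \<bullet> x}"
              by (intro open_Collect_less continuous_intros)
            show "indicator \<omega> y *\<^sub>R u s y = 0" if "y \<in> {x. h < e \<bullet> x}" for y
              using that h(2) by (auto simp: indicator_def)
          qed (use False a(1) \<mu>[OF s] in auto)
          from krasovskii_isCont[OF this] elim have "w s x = controlled_velocity a \<omega> u \<mu> s x"
            by auto
          also have "\<dots> = interaction_field a (\<mu> s) x"
            using h(2) False by (auto simp: controlled_velocity_def indicator_def)
          finally show ?thesis by (simp add: g_def)
        qed
      qed
      then have "(LINT x|\<mu> s. g x \<bullet> w s x) = (LINT x|\<mu> s. G (e \<bullet> x) * (e \<bullet> interaction_field a (\<mu> s) x))"
        by (intro integral_cong_AE) measurable
      also have "\<dots> \<le> 0"
        using mono_max_0_div_sqrt[of h] G_cont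
        by (intro interaction_field_dissipative a \<mu> s) (simp_all add: G_def[abs_def])
      finally show "(LINT x|\<mu> s. g x \<bullet> w s x) \<le> 0" .
    qed
  qed
  have "(LINT x|\<mu> t. \<phi> x) \<le> (LINT x|\<mu> 0. \<phi> x)"
  proof (rule weak_continuity_linear_growth[OF w \<mu> \<phi>_deriv g_cont _ \<phi>_bound dissip t])
    show "norm (g x) \<le> C" for x
      using mult_right_mono[OF G_bound norm_ge_zero, of "e \<bullet> x" e] by (simp add: g_def C_def)
  qed
  also have "(LINT x|\<mu> 0. \<phi> x) = 0"
    using compact_prob_measuresD(4)[OF \<mu>[OF order_refl]] h(1)
    by (intro integral_eq_zero_AE) (auto simp: \<mu>0 \<phi>_def elim!: eventually_mono)
  finally have "AE x in \<mu> t. \<phi> x = 0"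
    by (intro integral_nonneg_le_0_AE integrable_continuous_compact_prob \<mu> t \<phi>_nonneg
        GDERIV_imp_continuous_on[OF \<phi>_deriv])
  then have "AE x in \<mu> t. x \<in> {x. e \<bullet> x \<le> h}"
    by eventually_elim (simp add: \<phi>_def max_def split: if_splits)
  then show ?thesis
    using compact_prob_measuresD(2)[OF \<mu>[OF t]]
    by (intro measure_support_subset_closed closed_Collect_le continuous_intros)
qed

section \<open>Invariance of the union of balls\<close>

text \<open>The distance to the set of centres attains its maximum on the compact \<open>S\<close>,
  and this maximum is the radius sought. As there are finitely many centres, each point has a
  nearest one.\<close>

lemma compact_subset_Union_cball:
  fixes x :: "'i \<Rightarrow> 'a::heine_borel"
  assumes "compact S" "finite I" "I \<noteq> {}" "r > 0" "S \<subseteq> (\<Union>i\<in>I. ball (x i) r)"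
  obtains \<rho> where "0 \<le> \<rho>" "\<rho> < r" "S \<subseteq> (\<Union>i\<in>I. cball (x i) \<rho>)"
proof (cases "S = {}")
  case True
  then show ?thesis using assms by (intro that[of 0]) auto
next
  case False
  have "continuous_on S (\<lambda>y. infdist y (x ` I))"
    by (intro continuous_intros)
  from continuous_attains_sup[OF assms(1) False this]
  obtain y where y: "y \<in> S" "\<And>z. z \<in> S \<Longrightarrow> infdist z (x ` I) \<le> infdist y (x ` I)"
    by blast
  obtain i where i: "i \<in> I" "dist (x i) y < r"
    using y(1) assms(5) by auto
  show ?thesis
  proof (rule that[of "infdist y (x ` I)"])
    show "infdist y (x ` I) < r"
      using infdist_le[of "x i" "x ` I" y] i by (simp add: dist_commute)
    show "S \<subseteq> (\<Union>i\<in>I. cball (x i) (infdist y (x ` I)))"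
    proof
      fix z assume z: "z \<in> S"
      have "closed (x ` I)" "x ` I \<noteq> {}"
        using assms by (auto simp: finite_imp_closed)
      from infdist_attains_inf[where y = z, OF this]
      obtain q where "q \<in> x ` I" "infdist z (x ` I) = dist z q" .
      then obtain j where "j \<in> I" "infdist z (x ` I) = dist z (x j)"
        by blast
      with y(2)[OF z] show "z \<in> (\<Union>i\<in>I. cball (x i) (infdist y (x ` I)))"
        by (auto simp: dist_commute)
    qed
  qed (rule infdist_nonneg)
qed

text \<open>The integral of a test function bounded by \<open>1\<close> starts at \<open>1\<close>
  and cannot decrease, so the function is \<open>1\<close> almost everywhere. As it vanishes outside
  radius \<open>\<rho>' < r\<close>, the mass lies in closed balls inside the open ones, and a
  closed set is what captures the support.\<close>

lemma solution_support_balls: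
  fixes \<mu> :: "real \<Rightarrow> 'a::euclidean_space measure" and x :: "'i \<Rightarrow> 'a"
  assumes a: "continuous_on {0..} a"
    and sol: "is_solution a \<omega> u \<mu>0 \<mu>"
    and I: "finite I" "I \<noteq> {}" and r: "r > 0"
    and disj: "disjoint_family_on (\<lambda>i. ball (x i) r) I"
    and \<omega>: "\<omega> = (\<Union>i\<in>I. ball (x i) r)"
    and u: "\<And>t i y. i \<in> I \<Longrightarrow> y \<in> ball (x i) r - {x i} \<Longrightarrow>
      u t y = - (M *\<^sub>R ((y - x i) /\<^sub>R norm (y - x i)))"
    and \<epsilon>: "\<epsilon> \<le> M" "\<And>t y. t \<ge> 0 \<Longrightarrow> y \<in> \<omega> \<Longrightarrow> norm (interaction_field a (\<mu> t) y) \<le> \<epsilon>"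
    and supp: "measure_support \<mu>0 \<subseteq> \<omega>"
    and t: "t \<ge> 0"
  shows "measure_support (\<mu> t) \<subseteq> \<omega>"
proof -
  obtain w where w: "weak_continuity_equation w \<mu>"
    and kras: "AE t in lborel. 0 \<le> t \<longrightarrow>
      (AE x in \<mu> t. w t x \<in> krasovskii (controlled_velocity a \<omega> u \<mu> t) x)"
    and \<mu>: "\<And>t. t \<ge> 0 \<Longrightarrow> \<mu> t \<in> compact_prob_measures" and \<mu>0: "\<mu> 0 = \<mu>0"
    using sol unfolding is_solution_def by auto
  note D0 = compact_prob_measuresD[OF \<mu>[OF order_refl], unfolded \<mu>0]
  note Dt = compact_prob_measuresD[OF \<mu>[OF t]]
  interpret P0: prob_space \<mu>0 by (rule D0)
  interpret Pt: prob_space "\<mu> t" by (rule Dt)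
  obtain \<rho> where \<rho>: "0 \<le> \<rho>" "\<rho> < r" "measure_support \<mu>0 \<subseteq> (\<Union>i\<in>I. cball (x i) \<rho>)"
    using compact_subset_Union_cball[OF D0(3) I r supp[unfolded \<omega>]] .
  \<comment> \<open>The midpoint leaves room for the transition of the cutoff between
    \<open>\<rho>\<close> and \<open>\<rho>'\<close>, strictly inside radius \<open>r\<close>. The
    constants \<open>k\<close> and \<open>b\<close> solve \<open>k * \<rho>\<^sup>2 = b - 1\<close>
    and \<open>k * \<rho>'\<^sup>2 = b\<close>.\<close>
  define \<rho>' where "\<rho>' = (\<rho> + r) / 2"
  define k where "k = 1 / (\<rho>'\<^sup>2 - \<rho>\<^sup>2)"
  define b where "b = k * \<rho>'\<^sup>2"
  have \<rho>': "\<rho> < \<rho>'" "\<rho>' < r"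
    using \<rho> by (auto simp: \<rho>'_def)
  then have "\<rho>\<^sup>2 < \<rho>'\<^sup>2"
    using \<rho>(1) by (intro power_strict_mono) auto
  then have k: "k > 0" "b - 1 = k * \<rho>\<^sup>2"
    by (simp_all add: k_def b_def divide_simps)
  have inner: "k * (norm z)\<^sup>2 \<le> b - 1" if "norm z \<le> \<rho>" for z :: 'a
    unfolding k(2) using that k(1) by (intro mult_left_mono power_mono) auto
  have outer: "b \<le> k * (norm z)\<^sup>2" if "norm z \<ge> \<rho>'" for z :: 'a
    unfolding b_def using that k(1) \<rho> \<rho>' by (intro mult_left_mono power_mono) auto
  define \<eta> where "\<eta> i y = cutoff b (k * (norm (y - x i))\<^sup>2)" for i y
  define \<eta>' where "\<eta>' i y = (cutoff_deriv b (k * (norm (y - x i))\<^sup>2) * (2 * k)) *\<^sub>R (y - x i)" for i y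
  define \<psi> where "\<psi> y = (\<Sum>i\<in>I. \<eta> i y)" for y
  define g where "g y = (\<Sum>i\<in>I. \<eta>' i y)" for y
  have \<eta>: "0 \<le> \<eta> i y" "\<eta> i y \<le> 1" for i y
    by (simp_all add: \<eta>_def cutoff_nonneg cutoff_le_1)
  have \<eta>_inner: "\<eta> i y = 1" if "y \<in> cball (x i) \<rho>" for i y
    using inner[of "y - x i"] that by (simp add: \<eta>_def cutoff_eq_1 dist_norm norm_minus_commute)
  have \<eta>_outer: "\<eta> i y = 0" if "y \<notin> ball (x i) \<rho>'" for i y
    using outer[of "y - x i"] that by (simp add: \<eta>_def cutoff_eq_0 dist_norm norm_minus_commute)
  have \<psi>_deriv: "GDERIV \<psi> y :> g y" for y
  proof -
    have "GDERIV (\<eta> i) y :> \<eta>' i y" for i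
      unfolding \<eta>_def[abs_def] \<eta>'_def by (rule GDERIV_cutoff_norm)
    then show ?thesis
      unfolding \<psi>_def[abs_def] g_def gderiv_def inner_sum_right by (intro has_derivative_sum)
  qed
  have g_cont: "continuous_on UNIV g"
    unfolding g_def[abs_def] \<eta>'_def by (intro continuous_on_sum continuous_on_cutoff_gradient)
  have \<psi>_outer: "\<psi> y = 0" if "y \<notin> (\<Union>i\<in>I. ball (x i) \<rho>')" for y
    unfolding \<psi>_def using that \<eta>_outer by (intro sum.neutral) auto
  have "{y. \<psi> y \<noteq> 0} \<subseteq> (\<Union>i\<in>I. ball (x i) \<rho>')"
    using \<psi>_outer by blast
  moreover have "bounded (\<Union>i\<in>I. ball (x i) \<rho>')"
    using I by auto
  ultimately have \<psi>_supp: "compact (closure {y. \<psi> y \<noteq> 0})"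
    by (meson bounded_subset compact_closure)
  \<comment> \<open>Disjointness of the balls leaves at most one nonzero summand at each
    point.\<close>
  have \<psi>_le_1: "\<psi> y \<le> 1" for y
  proof (cases "y \<in> (\<Union>i\<in>I. ball (x i) \<rho>')")
    case True
    then obtain i where i: "i \<in> I" "y \<in> ball (x i) \<rho>'" by auto
    have "\<eta> j y = 0" if "j \<in> I - {i}" for j
    proof (rule \<eta>_outer)
      have "ball (x i) r \<inter> ball (x j) r = {}"
        using disjoint_family_onD[OF disj i(1), of j] that by auto
      moreover have "ball (x i) \<rho>' \<subseteq> ball (x i) r" "ball (x j) \<rho>' \<subseteq> ball (x j) r"
        using \<rho>'(2) by (simp_all add: subset_ball)
      ultimately show "y \<notin> ball (x j) \<rho>'"
        using i(2) by blast
    qed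
    then have "\<psi> y = \<eta> i y"
      unfolding \<psi>_def using sum.remove[OF I(1) i(1), of "\<lambda>i. \<eta> i y"] by simp
    then show ?thesis using \<eta>(2) by simp
  qed (simp add: \<psi>_outer)
  have \<psi>_inner: "\<psi> y = 1" if y: "y \<in> (\<Union>i\<in>I. cball (x i) \<rho>)" for y
  proof -
    obtain i where i: "i \<in> I" "y \<in> cball (x i) \<rho>" using y by auto
    have "\<eta> i y \<le> \<psi> y"
      unfolding \<psi>_def using I(1) i(1) \<eta>(1) by (intro member_le_sum) auto
    then show ?thesis
      using \<eta>_inner[OF i(2)] \<psi>_le_1[of y] by simp
  qed
  have "AE y in \<mu>0. \<psi> y = 1"
    using D0(4) by eventually_elim (use \<psi>_inner \<rho>(3) in blast)
  then have int0: "(LINT y|\<mu>0. \<psi> y) = 1"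
    using integral_cong_AE[of \<psi> \<mu>0 "\<lambda>_. 1"] integrable_continuous_compact_prob[OF
        GDERIV_imp_continuous_on[OF \<psi>_deriv] \<mu>[OF order_refl]]
    by (simp add: \<mu>0 P0.prob_space)
  have increasing: "AE s in lborel. 0 \<le> s \<longrightarrow> 0 \<le> (LINT y|\<mu> s. g y \<bullet> w s y)"
    using kras
  proof eventually_elim
    case (elim s)
    show ?case
    proof
      assume s: "0 \<le> s"
      then have "AE y in \<mu> s. w s y \<in> krasovskii (controlled_velocity a \<omega> u \<mu> s) y"
        using elim by simp
      then have "AE y in \<mu> s. 0 \<le> g y \<bullet> w s y"
      proof eventually_elim
        case (elim y)
        have "0 \<le> \<eta>' i y \<bullet> w s y" if i: "i \<in> I" for i
        \<comment> \<open>The gradient vanishes up to radius \<open>\<rho>\<close>, hence at the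
          centre, and from \<open>\<rho>'\<close> on, hence at the bounding sphere. In the annulus
          between them the control is continuous.\<close>
        proof (cases "norm (y - x i) \<le> \<rho> \<or> norm (y - x i) \<ge> \<rho>'")
          case True
          then show ?thesis
            using inner[of "y - x i"] outer[of "y - x i"] by (auto simp: \<eta>'_def cutoff_deriv_eq_0)
        next
          case False
          define n where "n = norm (y - x i)"
          have "\<rho> < n"
            using False by (simp add: n_def)
          with \<rho>(1) have n: "n > 0"
            by linarith
          have y: "y \<in> ball (x i) r - {x i}"
            using False n \<rho>' by (auto simp: n_def dist_norm norm_minus_commute)
          then have y\<omega>: "y \<in> \<omega>"
            using i \<omega> by auto
          have "isCont (controlled_velocity a \<omega> u \<mu> s) y"
          proof (rule isCont_controlled_velocity[where S = "ball (x i) r - {x i}"])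
            show "indicator \<omega> z *\<^sub>R u s z = - (M *\<^sub>R ((z - x i) /\<^sub>R norm (z - x i)))"
              if "z \<in> ball (x i) r - {x i}" for z
              using u[OF i that] that i by (simp add: \<omega> indicator_def) blast
            show "isCont (\<lambda>z. - (M *\<^sub>R ((z - x i) /\<^sub>R norm (z - x i)))) y"
              using y by (intro continuous_intros) auto
          qed (use a \<mu>[OF s] y in \<open>auto intro: open_delete\<close>)
          from krasovskii_isCont[OF this] elim
          have "w s y = interaction_field a (\<mu> s) y - M *\<^sub>R ((y - x i) /\<^sub>R n)"
            using u[OF i y] y\<omega> by (auto simp: controlled_velocity_def n_def)
          then have "(y - x i) \<bullet> w s y = (y - x i) \<bullet> interaction_field a (\<mu> s) y - M * n"
            using n by (simp add: inner_diff_right n_def dot_square_norm power2_eq_square)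
          \<comment> \<open>By Cauchy-Schwarz the interaction contributes at most
            \<open>\<epsilon>\<close> to the outward speed, while the control contributes
            \<open>- M\<close>.\<close>
          also have "\<dots> \<le> n * \<epsilon> - M * n"
            using order_trans[OF norm_cauchy_schwarz mult_left_mono[OF \<epsilon>(2)[OF s y\<omega>] norm_ge_zero]]
            by (simp add: n_def)
          also have "\<dots> \<le> 0"
            using \<epsilon>(1) n by (simp add: mult.commute)
          \<comment> \<open>The cutoff does not increase outwards and the velocity does not point
            outwards: two nonpositive factors.\<close>
          finally show ?thesis
            unfolding \<eta>'_def inner_scaleR_left using k(1)
            by (intro mult_nonpos_nonpos[OF mult_nonpos_nonneg[OF cutoff_deriv_nonpos]]) auto
        qed
        then show ?case
          unfolding g_def inner_sum_left by (intro sum_nonneg)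
      qed
      then show "0 \<le> (LINT y|\<mu> s. g y \<bullet> w s y)"
        by (rule integral_nonneg_AE)
    qed
  qed
  have eqn: "(LINT y|\<mu> t. \<psi> y) = (LINT y|\<mu> 0. \<psi> y) + (LINT s:{0..t}|lborel. (LINT y|\<mu> s. g y \<bullet> w s y))"
    using w \<psi>_deriv g_cont \<psi>_supp t unfolding weak_continuity_equation_def by blast
  have "0 \<le> (LINT s:{0..t}|lborel. (LINT y|\<mu> s. g y \<bullet> w s y))"
    unfolding set_lebesgue_integral_def using increasing
    by (intro integral_nonneg_AE) (auto simp: indicator_def elim!: eventually_mono)
  with eqn int0 have "1 \<le> (LINT y|\<mu> t. \<psi> y)"
    by (simp add: \<mu>0)
  moreover have \<psi>_int: "integrable (\<mu> t) \<psi>"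
    by (intro integrable_continuous_compact_prob GDERIV_imp_continuous_on[OF \<psi>_deriv] \<mu> t)
  ultimately have "(LINT y|\<mu> t. 1 - \<psi> y) \<le> 0"
    by (simp add: Pt.prob_space)
  then have "AE y in \<mu> t. 1 - \<psi> y = 0"
    using \<psi>_int \<psi>_le_1 by (intro integral_nonneg_le_0_AE) auto
  then have "AE y in \<mu> t. y \<in> (\<Union>i\<in>I. cball (x i) \<rho>')"
  proof eventually_elim
    case (elim y)
    then have "y \<in> (\<Union>i\<in>I. ball (x i) \<rho>')"
      using \<psi>_outer[of y] by auto
    then show ?case using ball_subset_cball by blast
  qed
  then have "measure_support (\<mu> t) \<subseteq> (\<Union>i\<in>I. cball (x i) \<rho>')"
    using I(1) Dt(2) by (intro measure_support_subset_closed closed_UN) auto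
  also have "\<dots> \<subseteq> \<omega>"
    unfolding \<omega> using \<rho>' by (intro UN_mono) auto
  finally show ?thesis .
qed

section \<open>Admissibility of the region and of the control, and the bound on distances to the
  support\<close>

lemma admissible_regions_Union_ball:
  fixes x :: "'i \<Rightarrow> 'a::euclidean_space"
  assumes "finite I" "real (card I) * measure lebesgue (ball (0::'a) r) \<le> c" "r \<ge> 0"
  shows "(\<Union>i\<in>I. ball (x i) r) \<in> admissible_regions c"
proof -
  have eq: "emeasure lebesgue (ball (x i) r) = ennreal (measure lebesgue (ball (0::'a) r))" for i
    using emeasure_lborel_ball_finite[of "x i" r] content_ball[OF assms(3), of "x i"]
      content_ball[OF assms(3), of "0::'a"]
    by (simp add: emeasure_eq_ennreal_measure less_top measure_completion)
  have "emeasure lebesgue (\<Union>i\<in>I. ball (x i) r) \<le> (\<Sum>i\<in>I. emeasure lebesgue (ball (x i) r))"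
    using assms(1) by (intro emeasure_subadditive_finite) auto
  also have "\<dots> = ennreal (real (card I) * measure lebesgue (ball (0::'a) r))"
    unfolding eq by (simp add: ennreal_mult'' ennreal_of_nat_eq_real_of_nat)
  also have "\<dots> \<le> ennreal c"
    using assms(2) by (rule ennreal_leI)
  finally have "emeasure lebesgue (\<Union>i\<in>I. ball (x i) r) \<le> ennreal c" .
  moreover have "(\<Union>i\<in>I. ball (x i) r) \<in> sets lebesgue"
    by (intro sets_completionI_sets) (auto intro: borel_open)
  ultimately show ?thesis
    by (simp add: admissible_regions_def)
qed

text \<open>As the balls are disjoint, \<open>u\<close> equals at all times a finite sum
  \<open>v\<close> of radial fields restricted to the balls; this explicit formula gives
  measurability in both variables.\<close>

lemma admissible_controls_balls:
  fixes x :: "'i \<Rightarrow> 'a::euclidean_space"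
  assumes I: "finite I" and disj: "disjoint_family_on (\<lambda>i. ball (x i) r) I" and M: "M \<ge> 0"
    and u: "\<And>t i y. i \<in> I \<Longrightarrow> y \<in> ball (x i) r - {x i} \<Longrightarrow>
      u t y = - (M *\<^sub>R ((y - x i) /\<^sub>R norm (y - x i)))"
    and u0: "\<And>t y. y \<notin> (\<Union>i\<in>I. ball (x i) r - {x i}) \<Longrightarrow> u t y = 0"
  shows "u \<in> admissible_controls M"
proof -
  define v where "v y = (\<Sum>i\<in>I. indicator (ball (x i) r) y *\<^sub>R - (M *\<^sub>R ((y - x i) /\<^sub>R norm (y - x i))))"
    for y
  have uv: "u t y = v y" for t y
  proof (cases "y \<in> (\<Union>i\<in>I. ball (x i) r - {x i})")
    case True
    then obtain i where i: "i \<in> I" "y \<in> ball (x i) r - {x i}" by auto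
    have "y \<notin> ball (x j) r" if "j \<in> I - {i}" for j
      using disjoint_family_onD[OF disj i(1), of j] that i(2) by blast
    then have "v y = indicator (ball (x i) r) y *\<^sub>R - (M *\<^sub>R ((y - x i) /\<^sub>R norm (y - x i)))"
      unfolding v_def using I i(1) by (subst sum.remove[OF I i(1)]) simp
    then show ?thesis
      using u[OF i] i(2) by simp
  next
    case False
    \<comment> \<open>Each summand vanishes: either \<open>y\<close> is outside the ball, or
      \<open>y = x i\<close> and the vector \<open>y - x i\<close> is \<open>0\<close>, in agreement
      with the value of \<open>u\<close> at the centres.\<close>
    then have "v y = 0"
      unfolding v_def by (intro sum.neutral) (auto simp: indicator_def)
    then show ?thesis
      using u0[OF False] by simp
  qed
  have v_meas: "v \<in> borel_measurable borel"
    unfolding v_def[abs_def]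
    by (intro borel_measurable_sum borel_measurable_scaleR borel_measurable_indicator
        borel_measurable_uminus borel_measurable_inverse borel_measurable_norm
        borel_measurable_diff borel_measurable_const measurable_ident_sets) auto
  have "(\<lambda>p::real \<times> 'a. v (snd p)) \<in> borel_measurable borel"
    unfolding borel_prod[symmetric] using v_meas by measurable
  then have "(\<lambda>(t, y). u t y) \<in> borel_measurable lebesgue"
    by (intro measurable_completion) (simp add: uv case_prod_beta')
  moreover have "esssup lebesgue (\<lambda>y. ereal (norm (u t y))) \<le> ereal M" for t
  proof (rule esssup_I)
    show "(\<lambda>y. ereal (norm (u t y))) \<in> borel_measurable lebesgue"
      unfolding uv using v_meas by (intro measurable_completion) measurable
    have "norm (u t y) \<le> M" for y
    proof (cases "y \<in> (\<Union>i\<in>I. ball (x i) r - {x i})")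
      case True
      then obtain i where "i \<in> I" "y \<in> ball (x i) r - {x i}" by auto
      with u[OF this] M show ?thesis by (simp add: mult.assoc)
    qed (simp add: u0 M)
    then show "AE y in lebesgue. ereal (norm (u t y)) \<le> ereal M"
      by simp
  qed
  ultimately show ?thesis
    by (simp add: admissible_controls_def)
qed

text \<open>Halfspace bounds in the direction from \<open>y\<close> to \<open>z\<close> replace a bound on the diameter of the
  convex hull of the balls.\<close>
lemma solution_support_dist_le:
  fixes \<mu> :: "real \<Rightarrow> 'a::euclidean_space measure" and x :: "'i \<Rightarrow> 'a"
  assumes a: "continuous_on {0..} a" "\<And>s. s \<ge> 0 \<Longrightarrow> a s \<ge> 0"
    and sol: "is_solution a (\<Union>i\<in>I. ball (x i) r) u \<mu>0 \<mu>"
    and I: "finite I" "I \<noteq> {}"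
    and d: "\<And>i j. i \<in> I \<Longrightarrow> j \<in> I \<Longrightarrow> norm (x i - x j) \<le> d"
    and supp: "measure_support \<mu>0 \<subseteq> (\<Union>i\<in>I. ball (x i) r)"
    and t: "t \<ge> 0" and y: "y \<in> (\<Union>i\<in>I. ball (x i) r)" and z: "z \<in> measure_support (\<mu> t)"
  shows "norm (y - z) \<le> d + 2 * r"
proof -
  \<comment> \<open>This is the unit vector from \<open>y\<close> to \<open>z\<close>, or
    \<open>0\<close> if they coincide; in both cases
    \<open>e \<bullet> v \<le> norm v\<close>.\<close>
  define e where "e = sgn (z - y)"
  obtain i where i: "i \<in> I" "norm (x i - y) < r"
    using y by (auto simp: dist_norm)
  have e: "e \<bullet> v \<le> norm v" for v
    using norm_cauchy_schwarz[of e v] by (auto simp: e_def norm_sgn split: if_splits)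
  \<comment> \<open>The centre \<open>x j\<close> lies furthest in direction \<open>e\<close>, so
    moving its level by \<open>r\<close> gives a halfspace containing all balls.\<close>
  have "Max ((\<lambda>i. e \<bullet> x i) ` I) \<in> (\<lambda>i. e \<bullet> x i) ` I"
    using I by (intro Max_in) auto
  then obtain j where j: "j \<in> I" "Max ((\<lambda>i. e \<bullet> x i) ` I) = e \<bullet> x j"
    by auto
  have j_max: "e \<bullet> x l \<le> e \<bullet> x j" if "l \<in> I" for l
    unfolding j(2)[symmetric] using that I(1) by (intro Max_ge) auto
  have sub: "(\<Union>i\<in>I. ball (x i) r) \<subseteq> {v. e \<bullet> v \<le> e \<bullet> x j + r}"
  proof
    fix v assume "v \<in> (\<Union>i\<in>I. ball (x i) r)"
    then obtain l where l: "l \<in> I" "norm (v - x l) < r"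
      by (auto simp: dist_norm norm_minus_commute)
    then show "v \<in> {v. e \<bullet> v \<le> e \<bullet> x j + r}"
      using j_max[OF l(1)] e[of "v - x l"] by (simp add: inner_diff_right)
  qed
  have "e \<bullet> z \<le> e \<bullet> x j + r"
    using solution_support_halfspace[OF a sol order_trans[OF supp sub] sub t] z by auto
  moreover have "e \<bullet> (x j - x i) \<le> d"
    using e[of "x j - x i"] d[OF j(1) i(1)] by simp
  moreover have "e \<bullet> (x i - y) \<le> r"
    using e[of "x i - y"] i(2) by simp
  \<comment> \<open>The radius enters twice: from \<open>z\<close> to the level of
    \<open>x j\<close>, and from \<open>x i\<close> to \<open>y\<close>.\<close>
  ultimately have "e \<bullet> (z - y) \<le> d + 2 * r"
    by (simp add: inner_diff_right)
  moreover have "e \<bullet> (z - y) = norm (y - z)"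
    by (cases "y = z") (simp_all add: e_def sgn_div_norm dot_square_norm power2_eq_square norm_minus_commute)
  ultimately show ?thesis
    by simp
qed

theorem theorem2p7:
  fixes a :: "real \<Rightarrow> real" and M c r R \<epsilon> :: real and N :: nat
    and x :: "nat \<Rightarrow> 'a::euclidean_space"
    and \<omega> :: "'a set" and u :: "real \<Rightarrow> 'a \<Rightarrow> 'a" and \<mu>0 :: "'a measure"
  assumes "\<exists>L. L-lipschitz_on {0..} a" and "\<And>s. s \<ge> 0 \<Longrightarrow> a s \<ge> 0"
    and "M > 0" and "c > 0" and "N \<ge> 2"
    and "r > 0" and "real N * measure lebesgue (ball (0::'a) r) \<le> c"
    and "R > 2 * r" and "\<epsilon> < M" and "\<And>s. 0 \<le> s \<Longrightarrow> s \<le> R \<Longrightarrow> s * a s \<le> \<epsilon>"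
    and "\<And>i j. i \<in> {1..N} \<Longrightarrow> j \<in> {1..N} \<Longrightarrow> i \<noteq> j \<Longrightarrow>
           2 * r \<le> norm (x i - x j) \<and> norm (x i - x j) \<le> R / 2"
    and "\<mu>0 \<in> compact_prob_measures"
    and "measure_support \<mu>0 \<subseteq> (\<Union>i\<in>{1..N}. ball (x i) r)"
    and "\<omega> = (\<Union>i\<in>{1..N}. ball (x i) r)"
    and "\<And>t i y. i \<in> {1..N} \<Longrightarrow> y \<in> ball (x i) r - {x i} \<Longrightarrow>
           u t y = - (M *\<^sub>R ((y - x i) /\<^sub>R norm (y - x i)))"
    and "\<And>t y. y \<notin> (\<Union>i\<in>{1..N}. ball (x i) r - {x i}) \<Longrightarrow> u t y = 0"
  shows "\<omega> \<in> admissible_regions c \<and> u \<in> admissible_controls M \<and>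
    (\<forall>\<mu>. is_solution a \<omega> u \<mu>0 \<mu> \<longrightarrow>
       (\<forall>t\<ge>0. measure_support (\<mu> t) \<subseteq> (\<Union>i\<in>{1..N}. ball (x i) r)))"
proof (intro conjI allI impI)
  let ?I = "{1..N}"
  have I: "finite ?I" "?I \<noteq> {}"
    using \<open>N \<ge> 2\<close> by auto
  have disj: "disjoint_family_on (\<lambda>i. ball (x i) r) ?I"
    unfolding disjoint_family_on_def
  proof (intro ballI impI)
    fix i j assume "i \<in> ?I" "j \<in> ?I" "i \<noteq> j"
    then have "2 * r \<le> dist (x i) (x j)"
      using assms(11)[of i j] by (simp add: dist_norm)
    then show "ball (x i) r \<inter> ball (x j) r = {}"
      by (intro disjoint_ballI) simp
  qed
  \<comment> \<open>As \<open>N \<ge> 2\<close>, there are two distinct centres, and the two bounds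
    on their distance give \<open>2 * r \<le> R / 2\<close>. Hence the distance bound
    \<open>R / 2 + 2 * r\<close> is at most \<open>R\<close>.\<close>
  have "1 \<in> ?I" "2 \<in> ?I"
    using \<open>N \<ge> 2\<close> by auto
  then have "2 * r \<le> R / 2"
    using assms(11)[of 1 2] by simp
  have a: "continuous_on {0..} a"
    using assms(1) lipschitz_on_continuous_on by blast
  show "\<omega> \<in> admissible_regions c"
    unfolding \<open>\<omega> = _\<close> using assms(6,7) by (intro admissible_regions_Union_ball) auto
  show "u \<in> admissible_controls M"
    using admissible_controls_balls[OF I(1) disj _ assms(15,16)] \<open>M > 0\<close> by simp
  fix \<mu> t assume sol: "is_solution a \<omega> u \<mu>0 \<mu>" and t: "(0::real) \<le> t"
  \<comment> \<open>At every time the support lies within \<open>R\<close> of each point of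
    \<open>\<omega>\<close>, so the smallness of \<open>s * a s\<close> on \<open>[0, R]\<close>
    bounds the field there.\<close>
  have "norm (interaction_field a (\<mu> s) y) \<le> \<epsilon>" if s: "s \<ge> 0" and y: "y \<in> \<omega>" for s y
  proof (rule norm_interaction_field_le[OF a])
    show \<mu>s: "\<mu> s \<in> compact_prob_measures"
      using sol s unfolding is_solution_def by blast
    show "AE z in \<mu> s. \<bar>a (norm (y - z))\<bar> * norm (y - z) \<le> \<epsilon>"
      using compact_prob_measuresD(4)[OF \<mu>s]
    proof eventually_elim
      case (elim z)
      have "norm (x i - x j) \<le> R / 2" if "i \<in> ?I" "j \<in> ?I" for i j
        using assms(11)[OF that] \<open>r > 0\<close> \<open>R > 2 * r\<close> by (cases "i = j") auto
      from solution_support_dist_le[OF a assms(2) sol[unfolded \<open>\<omega> = _\<close>] I this assms(13) s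
          y[unfolded \<open>\<omega> = _\<close>] elim]
      have "norm (y - z) \<le> R"
        using \<open>2 * r \<le> R / 2\<close> by simp
      then show ?case
        using assms(10)[of "norm (y - z)"] assms(2)[of "norm (y - z)"] by (simp add: mult.commute)
    qed
  qed
  then have "measure_support (\<mu> t) \<subseteq> \<omega>"
    using \<open>\<epsilon> < M\<close> assms(13,14)
    by (intro solution_support_balls[OF a sol I \<open>r > 0\<close> disj \<open>\<omega> = _\<close> assms(15) _ _ _ t,
        where \<epsilon> = \<epsilon>]) auto
  then show "measure_support (\<mu> t) \<subseteq> (\<Union>i\<in>?I. ball (x i) r)"
    using \<open>\<omega> = _\<close> by simp
qed

end
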